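(* Let $S_n$ be the star graph on $n \geq 2$ vertices. Then $cr(S_n) \leq 3n$.
   Context: Graphs are simple, undirected and labelled. The star $S_n$ on $n$ vertices has one center vertex adjacent to all $n-1$ other vertices (the leaves), and no other edges. A bicoloration of a graph $G=(V,E)$ is a mapping $\beta:V\to\{-1,1\}$, and a bicolored graph on $G$ is a pair $B=(G,\beta)$. Two bicolored graphs on the same vertex set are equal if they have the same edge set and the same coloring. $N_G(a)$ denotes the open neighborhood of $a$. For $a\in V$, the local complement $G_a$ is the graph on $V$ obtained from $G$ by toggling adjacency between every pair of distinct vertices of $N_G(a)$ (all other adjacencies are unchanged). The coloring $\beta_a$ is given by $\beta_a(x)=-\beta(x)$ if $x\in N_G(a)$ and $\beta_a(x)=\beta(x)$ otherwise. The local inversion of $B$ at $a$ is $B_a=(G_a,\beta_a)$. For a string $w\in V^*$ (a finite sequence of vertices, with length $|w|$), $B_w$ is defined inductively by $B_\varepsilon=B$ for the empty string $\varepsilon$, and $B_{w'a}=(B_{w'})_a$. For $A\subseteq V$, $B^{A}$ denotes the bicolored graph with the same underlying graph $G$ in which the colors of exactly the vertices in $A$ are flipped (multiplied by $-1$). The color reversal number $cr(G)$ is the minimum $\ell$ such that for every bicoloration $\beta$ of $G$, with $B=(G,\beta)$, there exists a string $w\in V^*$ with $|w|\le \ell$ and $B_w=B^{V}$. An inequality $cr(G)\le N$ includes the assertion that such an $\ell$ exists. *)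

theory Defs
  imports "HOL-Library.FuncSet" "HOL-Library.Extended_Nat"
begin

text \<open>Undirected graphs: an edge is the two-element set of its end vertices.\<close>

record 'a graph =
  verts :: "'a set"
  edges :: "'a set set"

definition simple_graph :: "'a graph \<Rightarrow> bool" where
  "simple_graph G \<longleftrightarrow> finite (verts G) \<and>
     edges G \<subseteq> {{x, y} | x y. x \<in> verts G \<and> y \<in> verts G \<and> x \<noteq> y}"

definition nbhd :: "'a graph \<Rightarrow> 'a \<Rightarrow> 'a set" where
  "nbhd G a = {x \<in> verts G. {a, x} \<in> edges G}"

definition star :: "'a set \<Rightarrow> 'a \<Rightarrow> 'a graph" where
  "star V c = \<lparr>verts = V, edges = {{c, x} | x. x \<in> V - {c}}\<rparr>"

definition pairs :: "'a set \<Rightarrow> 'a set set" where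
  "pairs A = {{x, y} | x y. x \<in> A \<and> y \<in> A \<and> x \<noteq> y}"

definition local_complement :: "'a graph \<Rightarrow> 'a \<Rightarrow> 'a graph" where
  "local_complement G a =
     \<lparr>verts = verts G,
      edges = (edges G - pairs (nbhd G a)) \<union> (pairs (nbhd G a) - edges G)\<rparr>"

text \<open>
  Bicolorations are extensional functions, i.e. \<open>undefined\<close> outside the vertex set, so that
  HOL equality of bicolored graphs compares colors on the vertices only. Flipping colors on
  a set of vertices does not change the values outside the vertex set.
\<close>

definition bicolorations :: "'a graph \<Rightarrow> ('a \<Rightarrow> int) set" where
  "bicolorations G = verts G \<rightarrow>\<^sub>E {-1, 1}"

type_synonym 'a bicolored_graph = "'a graph \<times> ('a \<Rightarrow> int)"

definition flip_on :: "'a set \<Rightarrow> ('a \<Rightarrow> int) \<Rightarrow> 'a \<Rightarrow> int" where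
  "flip_on A \<beta> = (\<lambda>x. if x \<in> A then - \<beta> x else \<beta> x)"

definition local_inversion :: "'a bicolored_graph \<Rightarrow> 'a \<Rightarrow> 'a bicolored_graph" where
  "local_inversion B a =
     (local_complement (fst B) a, flip_on (nbhd (fst B) a) (snd B))"

definition local_inversions :: "'a bicolored_graph \<Rightarrow> 'a list \<Rightarrow> 'a bicolored_graph" where
  "local_inversions B w = foldl local_inversion B w"

definition color_flip :: "'a bicolored_graph \<Rightarrow> 'a set \<Rightarrow> 'a bicolored_graph" where
  "color_flip B A = (fst B, flip_on A (snd B))"

text \<open>The infimum of the empty set is \<open>\<infinity>\<close>: the number is finite iff a uniform bound exists.\<close>

definition color_reversal_number :: "'a graph \<Rightarrow> enat" where
  "color_reversal_number G =
     Inf {enat l | l. \<forall>\<beta> \<in> bicolorations G. \<exists>w.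
            set w \<subseteq> verts G \<and> length w \<le> l \<and>
            local_inversions (G, \<beta>) w = color_flip (G, \<beta>) (verts G)}"

lemma simple_graph_star: "finite V \<Longrightarrow> c \<in> V \<Longrightarrow> simple_graph (star V c)"
  by (auto simp: simple_graph_def star_def)

lemma simple_graph_local_complement:
  "simple_graph G \<Longrightarrow> simple_graph (local_complement G a)"
  unfolding simple_graph_def local_complement_def pairs_def nbhd_def by auto

lemma flip_on_bicolorations:
  "\<beta> \<in> bicolorations G \<Longrightarrow> A \<subseteq> verts G \<Longrightarrow> flip_on A \<beta> \<in> bicolorations G"
  unfolding bicolorations_def flip_on_def PiE_def extensional_def Pi_def by auto

end

theory Submission
  imports Defs
begin

text \<open>
  Local inversions act on colors by flipping a set that depends on the graph only, so it suffices
  to find one string that works for all bicolorations at once.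

  The building block is the string \<open>bab\<close>, for a star centered at \<open>a\<close> and a leaf \<open>b\<close>.
  Inverting at \<open>b\<close> flips \<open>a\<close> alone and keeps the star; inverting at \<open>a\<close> flips \<open>V - {a}\<close>
  and completes the star to a complete graph; inverting at \<open>b\<close> flips \<open>V - {b}\<close> and reduces the
  complete graph to the star centered at \<open>b\<close>.  The symmetric difference of the three
  flipped sets is \<open>{b}\<close>.  So three inversions move the center from \<open>a\<close> to \<open>b\<close> and recolor
  precisely the new center (lemma \<open>local_inversions_move_center\<close>).

  Now send the center around a Hamiltonian cycle of the vertex set: each of the \<open>n\<close> vertices
  becomes the new center exactly once, and the star ends up centered where it started.  This flips
  every color with \<open>3 n\<close> inversions.  The assumption \<open>n \<ge> 2\<close> makes the vertex before the
  last step differ from the original center.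
\<close>

definition complete_graph :: "'a set \<Rightarrow> 'a graph" where
  "complete_graph V = \<lparr>verts = V, edges = pairs V\<rparr>"

lemma nbhd_star_center: "nbhd (star V a) a = V - {a}"
  by (auto simp: nbhd_def star_def doubleton_eq_iff)

lemma nbhd_star_leaf: "\<lbrakk>a \<in> V; b \<in> V; a \<noteq> b\<rbrakk> \<Longrightarrow> nbhd (star V a) b = {a}"
  by (auto simp: nbhd_def star_def doubleton_eq_iff)

lemma nbhd_complete_graph: "b \<in> V \<Longrightarrow> nbhd (complete_graph V) b = V - {b}"
  by (auto simp: nbhd_def complete_graph_def pairs_def doubleton_eq_iff)

lemma pairs_eq_star_edges_Un:
  "a \<in> V \<Longrightarrow> pairs V = {{a, x} | x. x \<in> V - {a}} \<union> pairs (V - {a})"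
  unfolding pairs_def by (auto simp: insert_commute)

lemma star_edges_Int_pairs: "{{a, x} | x. x \<in> V - {a}} \<inter> pairs (V - {a}) = {}"
  by (auto simp: pairs_def doubleton_eq_iff)

lemma local_complement_star_leaf:
  assumes "a \<in> V" "b \<in> V" "a \<noteq> b"
  shows "local_complement (star V a) b = star V a"
  using assms by (simp add: local_complement_def nbhd_star_leaf pairs_def)

lemma local_complement_star_center:
  assumes "a \<in> V"
  shows "local_complement (star V a) a = complete_graph V"
  using pairs_eq_star_edges_Un[OF assms] star_edges_Int_pairs[of a V]
  unfolding local_complement_def nbhd_star_center
  by (auto simp: star_def complete_graph_def)

lemma local_complement_complete_graph:
  assumes "b \<in> V"
  shows "local_complement (complete_graph V) b = star V b"
  using pairs_eq_star_edges_Un[OF assms] star_edges_Int_pairs[of b V]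
  unfolding local_complement_def nbhd_complete_graph[OF assms]
  by (auto simp: star_def complete_graph_def)

text \<open>
  The flipped sets are \<open>{a}\<close>, \<open>V - {a}\<close> and \<open>V - {b}\<close>: the vertex \<open>b\<close> lies in one of them, and
  every other vertex of \<open>V\<close> lies in exactly two, so that its color is restored.
\<close>

lemma local_inversions_move_center:
  assumes "a \<in> V" "b \<in> V" "a \<noteq> b"
  shows "local_inversions (star V a, \<beta>) [b, a, b] = (star V b, flip_on {b} \<beta>)"
proof -
  have "flip_on (V - {b}) (flip_on (V - {a}) (flip_on {a} \<beta>)) = flip_on {b} \<beta>"
    using assms by (auto simp: flip_on_def)
  then show ?thesis
    using assms
    by (simp add: local_inversions_def local_inversion_def nbhd_star_leaf nbhd_star_center
        nbhd_complete_graph local_complement_star_leaf local_complement_star_center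
        local_complement_complete_graph)
qed

fun move_center_along :: "'a \<Rightarrow> 'a list \<Rightarrow> 'a list" where
  "move_center_along a [] = []"
| "move_center_along a (b # bs) = [b, a, b] @ move_center_along b bs"

lemma length_move_center_along: "length (move_center_along a bs) = 3 * length bs"
  by (induction bs arbitrary: a) auto

lemma set_move_center_along: "set (move_center_along a bs) \<subseteq> set (a # bs)"
proof (induction bs arbitrary: a)
  case (Cons b bs)
  then show ?case using Cons.IH[of b] by auto
qed simp

lemma local_inversions_append:
  "local_inversions B (v @ w) = local_inversions (local_inversions B v) w"
  by (simp add: local_inversions_def)

lemma flip_on_disjoint: "A \<inter> B = {} \<Longrightarrow> flip_on A (flip_on B \<beta>) = flip_on (A \<union> B) \<beta>"
  by (fastforce simp: flip_on_def fun_eq_iff)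

text \<open>
  Only consecutive centers have to differ, and each vertex may become the center only once.  The
  walk may therefore end at its starting vertex \<open>a\<close>, which is how a closed tour recolors \<open>a\<close> too.
\<close>

lemma local_inversions_move_center_along:
  assumes "a \<in> V" "set bs \<subseteq> V" "distinct bs" "bs \<noteq> [] \<Longrightarrow> hd bs \<noteq> a"
  shows "local_inversions (star V a, \<beta>) (move_center_along a bs) =
    (star V (last (a # bs)), flip_on (set bs) \<beta>)"
  using assms
proof (induction bs arbitrary: a \<beta>)
  case Nil
  then show ?case by (simp add: local_inversions_def flip_on_def)
next
  case (Cons b bs)
  have "hd bs \<noteq> b" if "bs \<noteq> []"
    using Cons.prems(3) that by (cases bs) auto
  then have "local_inversions (star V b, flip_on {b} \<beta>) (move_center_along b bs) =
      (star V (last (b # bs)), flip_on (set bs) (flip_on {b} \<beta>))"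
    using Cons.prems by (intro Cons.IH) auto
  moreover have "flip_on (set bs) (flip_on {b} \<beta>) = flip_on (set (b # bs)) \<beta>"
    using Cons.prems(3) by (simp add: flip_on_disjoint)
  moreover have "local_inversions (star V a, \<beta>) [b, a, b] = (star V b, flip_on {b} \<beta>)"
    using Cons.prems by (intro local_inversions_move_center) auto
  ultimately show ?case
    unfolding move_center_along.simps local_inversions_append by simp
qed

lemma color_reversal_number_le:
  assumes "\<And>\<beta>. \<beta> \<in> bicolorations G \<Longrightarrow> \<exists>w. set w \<subseteq> verts G \<and> length w \<le> l \<and>
    local_inversions (G, \<beta>) w = color_flip (G, \<beta>) (verts G)"
  shows "color_reversal_number G \<le> enat l"
  unfolding color_reversal_number_def using assms by (intro Inf_lower) blast

theorem theorem3:
  fixes V :: "'a set" and c :: 'a and n :: nat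
  assumes "finite V" and "c \<in> V" and "card V = n" and "n \<ge> 2"
  shows "color_reversal_number (star V c) \<le> enat (3 * n)"
proof (rule color_reversal_number_le)
  fix \<beta> :: "'a \<Rightarrow> int"
  obtain xs where xs: "set xs = V - {c}" "distinct xs"
    using finite_distinct_list[of "V - {c}"] assms(1) by auto
  let ?tour = "xs @ [c]"
  have set_tour: "set ?tour = V" and distinct_tour: "distinct ?tour"
    using xs assms(2) by auto
  have "xs \<noteq> []"
  proof
    assume "xs = []"
    then have "V = {c}" using set_tour by simp
    then show False using assms(3,4) by simp
  qed
  then have "hd ?tour \<in> V - {c}" using xs(1) by (simp flip: xs(1))
  then have "local_inversions (star V c, \<beta>) (move_center_along c ?tour) =
      (star V (last (c # ?tour)), flip_on (set ?tour) \<beta>)"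
    using set_tour distinct_tour assms(2) by (intro local_inversions_move_center_along) auto
  then have "local_inversions (star V c, \<beta>) (move_center_along c ?tour) =
      color_flip (star V c, \<beta>) V"
    using set_tour by (simp add: color_flip_def)
  moreover have "set (move_center_along c ?tour) \<subseteq> V"
    using set_move_center_along[of c ?tour] set_tour assms(2) by auto
  moreover have "length (move_center_along c ?tour) = 3 * n"
    using distinct_card[OF distinct_tour] set_tour assms(3)
    by (simp add: length_move_center_along)
  ultimately show "\<exists>w. set w \<subseteq> verts (star V c) \<and> length w \<le> 3 * n \<and>
      local_inversions (star V c, \<beta>) w = color_flip (star V c, \<beta>) (verts (star V c))"
    by (intro exI[of _ "move_center_along c ?tour"]) (simp add: star_def)
qed

end
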